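(* Let $1<p<\infty$ and let $(X,d,\mu)$ be a doubling metric measure space. Assume that $(X,d,\mu)$ supports the following Sobolev-type inequality: there exist positive real numbers $\theta, C$ such that for any $u\in B^\theta_{p,p}(X)$, $$\int_X|u-u_X|^p\,d\mu\le C\liminf_{t\to0^+}\int_X\frac{1}{\mu(B(x,t))}\int_{B(x,t)}\frac{|u(x)-u(y)|^p}{t^{\theta p}}\,d\mu(y)\,d\mu(x).$$ Then for that choice of $\theta$, the space $B^\theta_{p,p}(X)$ has dimension at most $1$.
   Context: Throughout, $(X,d)$ is a separable metric space with infinitely many points and $\mu$ is a Borel measure on $X$ with $0<\mu(B(x,r))<\infty$ for all $x\in X$, $r>0$, where $B(x,r)=\{y\in X: d(x,y)<r\}$. The space $(X,d,\mu)$ is a doubling metric measure space if there is a constant $C_{\mathrm D}$ such that $0<\mu(B(x,2r))\le C_{\mathrm D}\,\mu(B(x,r))<\infty$ for all $x\in X$, $r>0$. Functions are identified when they agree $\mu$-a.e. $B^\theta_{p,p}(X)$ is the vector space of $u\in L^p(X)$ with $$\|u\|_{B^\theta_{p,p}(X)}^p:=\int_X\int_X\frac{|u(y)-u(x)|^p}{d(x,y)^{\theta p}\,\mu(B(x,d(x,y)))}\,d\mu(y)\,d\mu(x)<\infty$$ (the integrand is taken to be $0$ when $x=y$). $u_X$ denotes the mean value $\mu(X)^{-1}\int_Xu\,d\mu$ of $u$ over $X$. *)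

theory Defs
  imports "HOL-Analysis.Analysis" "Jordan_Normal_Form.VS_Connect"
begin

text \<open>
  The space \<open>X\<close> is the universe of a type \<open>'a\<close> of class \<open>metric_space\<close>; separability is expressed by
  the class \<open>second_countable_topology\<close>, which for metric spaces is the same thing and
  is what the measurability rules for products of Borel spaces require.
\<close>

definition metric_measure_space ::
  "'a :: {metric_space, second_countable_topology} measure \<Rightarrow> bool" where
  "metric_measure_space M \<longleftrightarrow>
     infinite (UNIV :: 'a set) \<and> sets M = sets borel \<and>
     (\<forall>x r. r > 0 \<longrightarrow> 0 < emeasure M (ball x r) \<and> emeasure M (ball x r) < \<infinity>)"

definition doubling_metric_measure_space ::
  "'a :: {metric_space, second_countable_topology} measure \<Rightarrow> bool" where
  "doubling_metric_measure_space M \<longleftrightarrow>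
     metric_measure_space M \<and>
     (\<exists>C :: real. \<forall>x r. r > 0 \<longrightarrow>
        emeasure M (ball x (2 * r)) \<le> ennreal C * emeasure M (ball x r))"

definition Lp_fun :: "'a measure \<Rightarrow> real \<Rightarrow> ('a \<Rightarrow> real) set" where
  "Lp_fun M p = {u \<in> borel_measurable M. (\<integral>\<^sup>+x. ennreal (\<bar>u x\<bar> powr p) \<partial>M) < \<infinity>}"

text \<open>The \<open>p\<close>-th power of the Besov seminorm, as an extended nonnegative real.\<close>

definition besov_energy ::
  "'a :: metric_space measure \<Rightarrow> real \<Rightarrow> real \<Rightarrow> ('a \<Rightarrow> real) \<Rightarrow> ennreal" where
  "besov_energy M \<theta> p u =
     (\<integral>\<^sup>+x. \<integral>\<^sup>+y. (if x = y then 0 else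
        ennreal (\<bar>u y - u x\<bar> powr p /
          (dist x y powr (\<theta> * p) * measure M (ball x (dist x y))))) \<partial>M \<partial>M)"

definition besov_fun :: "'a :: metric_space measure \<Rightarrow> real \<Rightarrow> real \<Rightarrow> ('a \<Rightarrow> real) set" where
  "besov_fun M \<theta> p = {u \<in> Lp_fun M p. besov_energy M \<theta> p u < \<infinity>}"

text \<open>
  Functions are identified when they agree almost everywhere: the vectors of the Besov space
  are the classes of functions in \<open>besov_fun\<close>. The fields \<open>mult\<close> and \<open>one\<close> of the record type are not
  used for modules.
\<close>

definition ae_class :: "'a measure \<Rightarrow> ('a \<Rightarrow> real) \<Rightarrow> ('a \<Rightarrow> real) set" where
  "ae_class M u = {v \<in> borel_measurable M. AE x in M. v x = u x}"

definition besov_space ::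
  "'a :: metric_space measure \<Rightarrow> real \<Rightarrow> real \<Rightarrow> (real, ('a \<Rightarrow> real) set) module" where
  "besov_space M \<theta> p =
     \<lparr>carrier = ae_class M ` besov_fun M \<theta> p,
      mult = undefined, one = undefined,
      zero = ae_class M (\<lambda>x. 0),
      add = (\<lambda>U V. \<Union>u\<in>U. \<Union>v\<in>V. ae_class M (\<lambda>x. u x + v x)),
      smult = (\<lambda>c U. \<Union>u\<in>U. ae_class M (\<lambda>x. c * u x))\<rparr>"

text \<open>
  For a space of infinite measure the factor \<open>1 / \<mu>(X)\<close> is read as \<open>0\<close>, so the mean value is \<open>0\<close>;
  a function in \<open>L\<^sup>p\<close> need not be integrable in that case. If the measure is
  finite, then functions in \<open>L\<^sup>p\<close>, \<open>p \<ge> 1\<close>, are integrable.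
\<close>

definition mean_value :: "'a measure \<Rightarrow> ('a \<Rightarrow> real) \<Rightarrow> real" where
  "mean_value M u =
     (if emeasure M (space M) = \<infinity> then 0 else (\<integral>x. u x \<partial>M) / measure M (space M))"

definition local_energy ::
  "'a :: metric_space measure \<Rightarrow> real \<Rightarrow> real \<Rightarrow> real \<Rightarrow> ('a \<Rightarrow> real) \<Rightarrow> ennreal" where
  "local_energy M \<theta> p t u =
     (\<integral>\<^sup>+x. 1 / emeasure M (ball x t) *
        (\<integral>\<^sup>+y\<in>ball x t. ennreal (\<bar>u x - u y\<bar> powr p / t powr (\<theta> * p)) \<partial>M) \<partial>M)"

definition sobolev_type_inequality ::
  "'a :: metric_space measure \<Rightarrow> real \<Rightarrow> real \<Rightarrow> real \<Rightarrow> bool" where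
  "sobolev_type_inequality M \<theta> p C \<longleftrightarrow>
     (\<forall>u \<in> besov_fun M \<theta> p.
        (\<integral>\<^sup>+x. ennreal (\<bar>u x - mean_value M u\<bar> powr p) \<partial>M)
          \<le> ennreal C * Liminf (at_right 0) (\<lambda>t. local_energy M \<theta> p t u))"


subsection \<open>The Besov space is a real vector space\<close>

lemma metric_measure_space_sets:
  "metric_measure_space M \<Longrightarrow> sets M = sets borel"
  by (simp add: metric_measure_space_def)

lemma metric_measure_space_sigma_finite:
  fixes M :: "'a :: {metric_space, second_countable_topology} measure"
  assumes "metric_measure_space M"
  shows "sigma_finite_measure M"
proof
  fix x0 :: 'a
  have s [measurable_cong]: "sets M = sets borel" using assms by (rule metric_measure_space_sets)
  let ?A = "range (\<lambda>n. ball x0 (real (Suc n)))"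
  show "\<exists>A. countable A \<and> A \<subseteq> sets M \<and> \<Union> A = space M \<and> (\<forall>a\<in>A. emeasure M a \<noteq> \<infinity>)"
  proof (intro exI[of _ ?A] conjI ballI)
    show "countable ?A" by simp
    show "?A \<subseteq> sets M" by (auto simp: s)
    have "\<exists>n. dist x0 y < real (Suc n)" for y
      by (metis reals_Archimedean2 less_trans of_nat_less_iff lessI)
    then show "\<Union> ?A = space M"
      using sets_eq_imp_space_eq[OF s] by auto
    fix a assume "a \<in> ?A"
    then obtain n where "a = ball x0 (real (Suc n))" by auto
    then show "emeasure M a \<noteq> \<infinity>"
      using assms unfolding metric_measure_space_def
      by (metis of_nat_0_less_iff zero_less_Suc less_irrefl)
  qed
qed

lemma besov_integrand_measurable:
  fixes M :: "'a :: {metric_space, second_countable_topology} measure"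
  assumes "metric_measure_space M" and u [measurable]: "u \<in> borel_measurable M"
  shows "(\<lambda>(x, y). if x = y then 0 else
           ennreal (\<bar>u y - u x\<bar> powr p /
             (dist x y powr (\<theta> * p) * measure M (ball x (dist x y)))))
         \<in> borel_measurable (M \<Otimes>\<^sub>M M)"
proof -
  interpret sigma_finite_measure M
    using assms(1) by (rule metric_measure_space_sigma_finite)
  have s [measurable_cong]: "sets M = sets borel"
    using assms(1) by (rule metric_measure_space_sets)
  have sp: "space M = UNIV" using sets_eq_imp_space_eq[OF s] by simp
  have "{w \<in> space ((M \<Otimes>\<^sub>M M) \<Otimes>\<^sub>M M). dist (fst (fst w)) (snd w) < dist (fst (fst w)) (snd (fst w))}
          \<in> sets ((M \<Otimes>\<^sub>M M) \<Otimes>\<^sub>M M)" (is "?Q \<in> _")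
    by measurable
  from measurable_emeasure_Pair[OF this]
  have "(\<lambda>z. emeasure M (ball (fst z) (dist (fst z) (snd z)))) \<in> borel_measurable (M \<Otimes>\<^sub>M M)"
    by (rule measurable_cong[THEN iffD1, rotated])
       (auto simp: space_pair_measure sp vimage_def ball_def)
  then have [measurable]:
    "(\<lambda>z. measure M (ball (fst z) (dist (fst z) (snd z)))) \<in> borel_measurable (M \<Otimes>\<^sub>M M)"
    unfolding measure_def by measurable
  show ?thesis
    unfolding case_prod_beta by measurable
qed

lemma powr_sum_bound:
  fixes a b p :: real
  assumes "p > 0"
  shows "\<bar>a + b\<bar> powr p \<le> 2 powr p * (\<bar>a\<bar> powr p + \<bar>b\<bar> powr p)"
proof -
  have "\<bar>a + b\<bar> powr p \<le> (2 * max \<bar>a\<bar> \<bar>b\<bar>) powr p"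
    using assms by (intro powr_mono2) auto
  also have "\<dots> = 2 powr p * max \<bar>a\<bar> \<bar>b\<bar> powr p"
    by (simp add: powr_mult)
  also have "\<dots> \<le> 2 powr p * (\<bar>a\<bar> powr p + \<bar>b\<bar> powr p)"
    by (intro mult_left_mono) (auto simp: max_def)
  finally show ?thesis .
qed

lemma besov_fun_zero: "(\<lambda>x. 0) \<in> besov_fun M \<theta> p"
  by (simp add: besov_fun_def Lp_fun_def besov_energy_def if_distrib cong: if_cong)

lemma besov_fun_add:
  fixes M :: "'a :: {metric_space, second_countable_topology} measure"
  assumes M: "metric_measure_space M" and p: "p > 0"
    and u: "u \<in> besov_fun M \<theta> p" and v: "v \<in> besov_fun M \<theta> p"
  shows "(\<lambda>x. u x + v x) \<in> besov_fun M \<theta> p"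
proof -
  interpret sigma_finite_measure M
    using M by (rule metric_measure_space_sigma_finite)
  have [measurable]: "u \<in> borel_measurable M" "v \<in> borel_measurable M"
    using u v by (auto simp: besov_fun_def Lp_fun_def)
  let ?K = "ennreal (2 powr p)"
  have "(\<integral>\<^sup>+x. ennreal (\<bar>u x + v x\<bar> powr p) \<partial>M)
      \<le> (\<integral>\<^sup>+x. ?K * (ennreal (\<bar>u x\<bar> powr p) + ennreal (\<bar>v x\<bar> powr p)) \<partial>M)"
    using powr_sum_bound[OF p]
    by (intro nn_integral_mono)
       (simp flip: ennreal_plus ennreal_mult add: ennreal_leI)
  also have "\<dots> = ?K * ((\<integral>\<^sup>+x. ennreal (\<bar>u x\<bar> powr p) \<partial>M) + (\<integral>\<^sup>+x. ennreal (\<bar>v x\<bar> powr p) \<partial>M))"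
    by (simp add: nn_integral_cmult nn_integral_add)
  also have "\<dots> < \<infinity>"
    using u v by (auto simp: besov_fun_def Lp_fun_def ennreal_mult_less_top)
  finally have Lp: "(\<lambda>x. u x + v x) \<in> Lp_fun M p"
    by (simp add: Lp_fun_def)
  define k where "k w x y = (if x = y then 0 else
        ennreal (\<bar>w y - w x\<bar> powr p /
          (dist x y powr (\<theta> * p) * measure M (ball x (dist x y)))))" for w :: "'a \<Rightarrow> real" and x y
  have km [measurable]: "(\<lambda>(x, y). k w x y) \<in> borel_measurable (M \<Otimes>\<^sub>M M)"
    if "w \<in> borel_measurable M" for w
    using besov_integrand_measurable[OF M that, of p \<theta>] by (simp add: k_def case_prod_beta)
  have kle: "k (\<lambda>x. u x + v x) x y \<le> ?K * (k u x y + k v x y)" for x y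
  proof -
    define D where "D = dist x y powr (\<theta> * p) * measure M (ball x (dist x y))"
    have D: "D \<ge> 0" by (simp add: D_def)
    have "\<bar>(u y + v y) - (u x + v x)\<bar> powr p / D
        \<le> 2 powr p * (\<bar>u y - u x\<bar> powr p + \<bar>v y - v x\<bar> powr p) / D"
      using powr_sum_bound[OF p, of "u y - u x" "v y - v x"] D
      by (intro divide_right_mono) (auto simp: algebra_simps)
    also have "\<dots> = 2 powr p * (\<bar>u y - u x\<bar> powr p / D + \<bar>v y - v x\<bar> powr p / D)"
      by (simp add: add_divide_distrib distrib_left)
    finally show ?thesis
      using D unfolding k_def D_def[symmetric]
      by (auto simp flip: ennreal_plus ennreal_mult intro!: ennreal_leI)
  qed
  have [measurable]: "(\<lambda>y. k w x y) \<in> borel_measurable M"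
    if "w \<in> borel_measurable M" "x \<in> space M" for w x
    using measurable_Pair2[OF km[OF that(1)] that(2)] by simp
  have [measurable]: "(\<lambda>x. \<integral>\<^sup>+y. k w x y \<partial>M) \<in> borel_measurable M"
    if "w \<in> borel_measurable M" for w
    using borel_measurable_nn_integral_fst[OF km[OF that]] by simp
  have "besov_energy M \<theta> p (\<lambda>x. u x + v x) = (\<integral>\<^sup>+x. \<integral>\<^sup>+y. k (\<lambda>x. u x + v x) x y \<partial>M \<partial>M)"
    by (simp add: besov_energy_def k_def)
  also have "\<dots> \<le> (\<integral>\<^sup>+x. \<integral>\<^sup>+y. ?K * (k u x y + k v x y) \<partial>M \<partial>M)"
    by (intro nn_integral_mono kle)
  also have "\<dots> = (\<integral>\<^sup>+x. ?K * ((\<integral>\<^sup>+y. k u x y \<partial>M) + (\<integral>\<^sup>+y. k v x y \<partial>M)) \<partial>M)"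
    by (intro nn_integral_cong) (simp add: nn_integral_cmult nn_integral_add)
  also have "\<dots> = ?K * ((\<integral>\<^sup>+x. \<integral>\<^sup>+y. k u x y \<partial>M \<partial>M) + (\<integral>\<^sup>+x. \<integral>\<^sup>+y. k v x y \<partial>M \<partial>M))"
    by (simp add: nn_integral_cmult nn_integral_add)
  also have "\<dots> < \<infinity>"
    using u v by (auto simp: besov_fun_def besov_energy_def k_def ennreal_mult_less_top)
  finally show ?thesis
    using Lp by (simp add: besov_fun_def)
qed

lemma besov_fun_cmult:
  fixes M :: "'a :: {metric_space, second_countable_topology} measure"
  assumes M: "metric_measure_space M" and u: "u \<in> besov_fun M \<theta> p"
  shows "(\<lambda>x. c * u x) \<in> besov_fun M \<theta> p"
proof -
  interpret sigma_finite_measure M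
    using M by (rule metric_measure_space_sigma_finite)
  have um [measurable]: "u \<in> borel_measurable M"
    using u by (auto simp: besov_fun_def Lp_fun_def)
  let ?K = "ennreal (\<bar>c\<bar> powr p)"
  have "(\<integral>\<^sup>+x. ennreal (\<bar>c * u x\<bar> powr p) \<partial>M) = (\<integral>\<^sup>+x. ?K * ennreal (\<bar>u x\<bar> powr p) \<partial>M)"
    by (simp add: abs_mult powr_mult flip: ennreal_mult)
  also have "\<dots> = ?K * (\<integral>\<^sup>+x. ennreal (\<bar>u x\<bar> powr p) \<partial>M)"
    by (simp add: nn_integral_cmult)
  also have "\<dots> < \<infinity>"
    using u by (auto simp: besov_fun_def Lp_fun_def ennreal_mult_less_top)
  finally have Lp: "(\<lambda>x. c * u x) \<in> Lp_fun M p"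
    by (simp add: Lp_fun_def)
  define k where "k w x y = (if x = y then 0 else
        ennreal (\<bar>w y - w x\<bar> powr p /
          (dist x y powr (\<theta> * p) * measure M (ball x (dist x y)))))" for w :: "'a \<Rightarrow> real" and x y
  have km [measurable]: "(\<lambda>(x, y). k u x y) \<in> borel_measurable (M \<Otimes>\<^sub>M M)"
    using besov_integrand_measurable[OF M um, of p \<theta>] by (simp add: k_def case_prod_beta)
  have keq: "k (\<lambda>x. c * u x) x y = ?K * k u x y" for x y
    by (simp add: k_def abs_mult powr_mult right_diff_distrib[symmetric] flip: ennreal_mult)
  have [measurable]: "(\<lambda>y. k u x y) \<in> borel_measurable M" if "x \<in> space M" for x
    using measurable_Pair2[OF km that] by simp
  have [measurable]: "(\<lambda>x. \<integral>\<^sup>+y. k u x y \<partial>M) \<in> borel_measurable M"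
    using borel_measurable_nn_integral_fst[OF km] by simp
  have "besov_energy M \<theta> p (\<lambda>x. c * u x) = (\<integral>\<^sup>+x. \<integral>\<^sup>+y. k (\<lambda>x. c * u x) x y \<partial>M \<partial>M)"
    by (simp add: besov_energy_def k_def)
  also have "\<dots> = (\<integral>\<^sup>+x. ?K * (\<integral>\<^sup>+y. k u x y \<partial>M) \<partial>M)"
    unfolding keq by (intro nn_integral_cong) (simp add: nn_integral_cmult)
  also have "\<dots> = ?K * (\<integral>\<^sup>+x. \<integral>\<^sup>+y. k u x y \<partial>M \<partial>M)"
    by (simp add: nn_integral_cmult)
  also have "\<dots> < \<infinity>"
    using u by (auto simp: besov_fun_def besov_energy_def k_def ennreal_mult_less_top)
  finally show ?thesis
    using Lp by (simp add: besov_fun_def)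
qed

lemma besov_fun_measurable: "u \<in> besov_fun M \<theta> p \<Longrightarrow> u \<in> borel_measurable M"
  by (simp add: besov_fun_def Lp_fun_def)

lemma ae_class_self: "u \<in> borel_measurable M \<Longrightarrow> u \<in> ae_class M u"
  by (simp add: ae_class_def)

lemma ae_class_eqI: "AE x in M. u x = v x \<Longrightarrow> ae_class M u = ae_class M v"
  unfolding ae_class_def by auto

lemma ae_class_eq_iff:
  assumes "u \<in> borel_measurable M"
  shows "ae_class M u = ae_class M v \<longleftrightarrow> (AE x in M. u x = v x)"
  using ae_class_eqI[of u v M] ae_class_self[OF assms] by (auto simp: ae_class_def)

lemma besov_space_add_class:
  assumes "u \<in> borel_measurable M" "v \<in> borel_measurable M"
  shows "ae_class M u \<oplus>\<^bsub>besov_space M \<theta> p\<^esub> ae_class M v = ae_class M (\<lambda>x. u x + v x)"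
proof -
  have "ae_class M (\<lambda>x. u' x + v' x) = ae_class M (\<lambda>x. u x + v x)"
    if "u' \<in> ae_class M u" "v' \<in> ae_class M v" for u' v'
    using that by (intro ae_class_eqI) (auto simp: ae_class_def)
  then have "(\<Union>u'\<in>ae_class M u. \<Union>v'\<in>ae_class M v. ae_class M (\<lambda>x. u' x + v' x)) =
      (\<Union>u'\<in>ae_class M u. \<Union>v'\<in>ae_class M v. ae_class M (\<lambda>x. u x + v x))"
    by (intro SUP_cong refl)
  also have "\<dots> = ae_class M (\<lambda>x. u x + v x)"
    using ae_class_self[OF assms(1)] ae_class_self[OF assms(2)] by blast
  finally show ?thesis
    by (simp only: besov_space_def ring.simps)
qed

lemma besov_space_smult_class:
  assumes "u \<in> borel_measurable M"
  shows "c \<odot>\<^bsub>besov_space M \<theta> p\<^esub> ae_class M u = ae_class M (\<lambda>x. c * u x)"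
proof -
  have "ae_class M (\<lambda>x. c * u' x) = ae_class M (\<lambda>x. c * u x)" if "u' \<in> ae_class M u" for u'
    using that by (intro ae_class_eqI) (auto simp: ae_class_def)
  then have "(\<Union>u'\<in>ae_class M u. ae_class M (\<lambda>x. c * u' x)) =
      (\<Union>u'\<in>ae_class M u. ae_class M (\<lambda>x. c * u x))"
    by (intro SUP_cong refl)
  also have "\<dots> = ae_class M (\<lambda>x. c * u x)"
    using ae_class_self[OF assms] by blast
  finally show ?thesis
    by (simp only: besov_space_def module.simps)
qed

lemma besov_space_vectorspace:
  fixes M :: "'a :: {metric_space, second_countable_topology} measure"
  assumes M: "metric_measure_space M" and p: "p > 0"
  shows "vectorspace class_ring (besov_space M \<theta> p)"
proof -
  let ?V = "besov_space M \<theta> p"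
  have car: "carrier ?V = ae_class M ` besov_fun M \<theta> p"
    and zero: "\<zero>\<^bsub>?V\<^esub> = ae_class M (\<lambda>x. 0)"
    by (simp_all add: besov_space_def)
  note rules = car zero besov_space_add_class besov_space_smult_class besov_fun_measurable[of _ M \<theta> p]
    besov_fun_add[OF M p] besov_fun_cmult[OF M] besov_fun_zero class_ring_simps algebra_simps
  have ag: "abelian_group ?V"
  proof (rule abelian_groupI)
    fix x assume "x \<in> carrier ?V"
    then obtain u where u: "u \<in> besov_fun M \<theta> p" "x = ae_class M u" by (auto simp: car)
    have "ae_class M (\<lambda>x. (- 1) * u x) \<oplus>\<^bsub>?V\<^esub> x = \<zero>\<^bsub>?V\<^esub>"
      using u besov_fun_measurable[OF u(1)] by (subst u(2), subst besov_space_add_class) (auto simp: zero)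
    then show "\<exists>y\<in>carrier ?V. y \<oplus>\<^bsub>?V\<^esub> x = \<zero>\<^bsub>?V\<^esub>"
      using besov_fun_cmult[OF M u(1), of "- 1"] by (auto simp: car)
  qed (auto simp: rules)
  have "cring (class_ring :: real ring)"
    using class_field by (intro domain.axioms(1) field.axioms(1))
  then have "module class_ring ?V"
    using ag by (rule moduleI) (auto simp: rules)
  then show ?thesis
    unfolding vectorspace_def using class_field by auto
qed

end

theory Submission
  imports Defs
begin

text \<open>
  On \<open>B(x,t)\<close> the kernel of the local energy at scale \<open>t\<close> is at most the Besov kernel, because
  \<open>d(x,y) < t\<close>. Hence the local energy is bounded by the integral of the Besov kernel over
  \<open>{(x,y). d(x,y) < t}\<close>, and for a function of finite Besov energy this tail of a convergent
  integral vanishes as \<open>t \<rightarrow> 0\<close>. The Sobolev-type inequality then says \<open>u = u\<^sub>X\<close> almost everywhere,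
  so the Besov space contains at most the constants.
\<close>

text \<open>The singleton \<open>{v}\<close> generates the space but need not be independent. Since
  \<open>v\<close> may be zero, the trivial space and the line of constants are handled
  alike.\<close>

lemma (in vectorspace) fin_dim_dim_le_1I:
  assumes v: "v \<in> carrier V"
    and multiple: "\<And>w. w \<in> carrier V \<Longrightarrow> \<exists>c\<in>carrier K. w = c \<odot>\<^bsub>V\<^esub> v"
  shows "fin_dim \<and> dim \<le> 1"
proof -
  have sub: "{v} \<subseteq> carrier V" using v by simp
  have "v \<in> span {v}" using in_own_span[OF sub] by simp
  then have "carrier V \<subseteq> span {v}"
    using multiple submodule.smult_closed[OF span_is_submodule[OF sub]] by blast
  then have gen: "gen_set {v}"
    using span_is_subset2[OF sub] by auto
  then have "fin_dim" unfolding fin_dim_def using sub by blast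
  with gen v show ?thesis by (blast intro: dim_le1I)
qed

lemma local_energy_tendsto_0:
  fixes M :: "'a :: {metric_space, second_countable_topology} measure"
  assumes M: "metric_measure_space M" and \<theta>p: "\<theta> * p \<ge> 0"
    and u: "u \<in> besov_fun M \<theta> p"
  shows "((\<lambda>t. local_energy M \<theta> p t u) \<longlongrightarrow> 0) (at_right 0)"
proof -
  interpret sigma_finite_measure M
    using M by (rule metric_measure_space_sigma_finite)
  have s [measurable_cong]: "sets M = sets borel"
    using M by (rule metric_measure_space_sets)
  have um [measurable]: "u \<in> borel_measurable M"
    using u by (rule besov_fun_measurable)
  have fin: "emeasure M (ball x r) < \<infinity>" and pos: "0 < emeasure M (ball x r)" if "r > 0" for x r
    using M that by (auto simp: metric_measure_space_def)
  define k where "k x y = (if x = y then 0 else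
        ennreal (\<bar>u y - u x\<bar> powr p /
          (dist x y powr (\<theta> * p) * measure M (ball x (dist x y)))))" for x y
  have km [measurable]: "(\<lambda>(x, y). k x y) \<in> borel_measurable (M \<Otimes>\<^sub>M M)"
    using besov_integrand_measurable[OF M um, of p \<theta>] by (simp add: k_def case_prod_beta)
  \<comment> \<open>The cut-off integrand is a function of pairs, so that dominated convergence
    applies once, on the product space, with the uncut Besov integrand as majorant.\<close>
  define kt where "kt t z = (case z of (x, y) \<Rightarrow> k x y) *
      indicator {z. dist (fst z) (snd z) < t} z" for t z
  have ktm [measurable]: "kt t \<in> borel_measurable (M \<Otimes>\<^sub>M M)" for t
    unfolding kt_def by measurable
  define g where "g t = (\<integral>\<^sup>+z. kt t z \<partial>(M \<Otimes>\<^sub>M M))" for t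
  have energy: "(\<integral>\<^sup>+z. (case z of (x, y) \<Rightarrow> k x y) \<partial>(M \<Otimes>\<^sub>M M)) < \<infinity>"
    using u by (subst nn_integral_fst[OF km, symmetric])
      (simp add: besov_fun_def besov_energy_def k_def)

  have le: "local_energy M \<theta> p t u \<le> g t" if t: "t > 0" for t
  proof -
    have pointwise: "1 / emeasure M (ball x t) *
        (ennreal (\<bar>u x - u y\<bar> powr p / t powr (\<theta> * p)) * indicator (ball x t) y) \<le> kt t (x, y)"
      for x y
    proof (cases "x \<noteq> y \<and> dist x y < t")
      case True
      let ?d = "dist x y"
      have d: "?d > 0" using True by simp
      have m: "0 < measure M (ball x r)" "emeasure M (ball x r) = ennreal (measure M (ball x r))"
        if "r > 0" for r
        using fin[OF that, of x] pos[OF that, of x]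
        by (auto simp: measure_def enn2real_positive_iff)
      \<comment> \<open>Passing from the distance to the larger \<open>t\<close> increases both
        factors of the denominator: the balls are nested, and the exponent \<theta> * p is
        nonnegative.\<close>
      have "measure M (ball x ?d) \<le> measure M (ball x t)"
        using True fin[OF t, of x] by (intro measure_mono_fmeasurable) (auto simp: fmeasurable_def s)
      moreover have "?d powr (\<theta> * p) \<le> t powr (\<theta> * p)"
        using True \<theta>p by (intro powr_mono2) auto
      ultimately have mono: "?d powr (\<theta> * p) * measure M (ball x ?d) \<le>
          t powr (\<theta> * p) * measure M (ball x t)"
        by (intro mult_mono) auto
      \<comment> \<open>Strict positivity of the smaller denominator is essential for comparing the
        fractions, as division by zero would give 0.\<close>
      have "0 < ?d powr (\<theta> * p) * measure M (ball x ?d)"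
        using d m(1)[OF d] by (intro mult_pos_pos) simp_all
      then have "\<bar>u y - u x\<bar> powr p / (t powr (\<theta> * p) * measure M (ball x t)) \<le>
          \<bar>u y - u x\<bar> powr p / (?d powr (\<theta> * p) * measure M (ball x ?d))"
        by (rule frac_le[OF powr_ge_zero order_refl _ mono])
      moreover have "1 / emeasure M (ball x t) *
          ennreal (\<bar>u x - u y\<bar> powr p / t powr (\<theta> * p)) =
          ennreal (\<bar>u y - u x\<bar> powr p / (t powr (\<theta> * p) * measure M (ball x t)))"
        using m[OF t]
        by (simp add: divide_ennreal ennreal_mult' [symmetric] abs_minus_commute field_simps
            flip: ennreal_1)
      ultimately show ?thesis
        using True by (simp add: kt_def k_def ennreal_leI)
    \<comment> \<open>Otherwise the left side vanishes: either the indicator is 0, or x = y and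
      \<open>0 powr p = 0\<close>.\<close>
    qed (auto simp: indicator_def)
    have [measurable]: "ball x t \<in> sets M" for x
      by (simp add: s)
    have meas: "(\<lambda>y. ennreal (\<bar>u x - u y\<bar> powr p / t powr (\<theta> * p)) *
        indicator (ball x t) y) \<in> borel_measurable M" for x
      by measurable
    have "local_energy M \<theta> p t u = (\<integral>\<^sup>+x. \<integral>\<^sup>+y. 1 / emeasure M (ball x t) *
        (ennreal (\<bar>u x - u y\<bar> powr p / t powr (\<theta> * p)) * indicator (ball x t) y) \<partial>M \<partial>M)"
      unfolding local_energy_def
      by (simp only: nn_integral_cmult[OF meas])
    also have "\<dots> \<le> (\<integral>\<^sup>+x. \<integral>\<^sup>+y. kt t (x, y) \<partial>M \<partial>M)"
      by (intro nn_integral_mono pointwise)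
    also have "\<dots> = g t"
      unfolding g_def by (rule nn_integral_fst[OF ktm])
    finally show ?thesis .
  qed

  have "(g \<longlongrightarrow> 0) (at_right 0)"
  \<comment> \<open>Dominated convergence concerns sequences, so the one-sided limit is tested along
    sequences; 1 is just some point to the right of 0.\<close>
  proof (rule tendsto_at_right_sequentially[of 0 1])
    fix S :: "nat \<Rightarrow> real"
    assume S: "S \<longlonglongrightarrow> 0"
    \<comment> \<open>The cut-off never removes the diagonal while \<open>S n\<close> is positive,
      and isolated points give the diagonal positive measure. There the limit is 0 because
      \<open>k\<close> is set to 0 for x = y.\<close>
    have "(\<lambda>n. kt (S n) z) \<longlonglongrightarrow> 0" for z
    proof (cases "fst z = snd z")
      case True
      then show ?thesis by (simp add: kt_def k_def case_prod_beta)
    next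
      case False
      then have "eventually (\<lambda>n. S n < dist (fst z) (snd z)) sequentially"
        using S by (intro order_tendstoD) auto
      then have "eventually (\<lambda>n. kt (S n) z = 0) sequentially"
        by eventually_elim (simp add: kt_def)
      then show ?thesis by (rule tendsto_eventually)
    qed
    then have "(\<lambda>n. \<integral>\<^sup>+z. kt (S n) z \<partial>(M \<Otimes>\<^sub>M M)) \<longlonglongrightarrow> (\<integral>\<^sup>+z. 0 \<partial>(M \<Otimes>\<^sub>M M))"
      by (intro nn_integral_dominated_convergence[OF _ _ km _ energy])
         (auto simp: kt_def indicator_def)
    then show "(\<lambda>n. g (S n)) \<longlonglongrightarrow> 0" by (simp add: g_def)
  qed simp
  then show ?thesis
    by (rule tendsto_sandwich[OF _ _ tendsto_const, rotated 2])
       (auto simp: eventually_at_right_less intro: eventually_mono[OF eventually_at_right_less] le)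
qed

text \<open>The vanishing limit makes the right side of the inequality 0. In infinite measure
  \<open>mean_value M u\<close> is 0 by convention, so \<open>u\<close> then vanishes almost
  everywhere.\<close>

lemma sobolev_type_inequality_AE_const:
  fixes M :: "'a :: {metric_space, second_countable_topology} measure"
  assumes "metric_measure_space M" and "\<theta> * p \<ge> 0"
    and sob: "sobolev_type_inequality M \<theta> p C" and u: "u \<in> besov_fun M \<theta> p"
  shows "AE x in M. u x = mean_value M u"
proof -
  have [measurable]: "u \<in> borel_measurable M"
    using u by (rule besov_fun_measurable)
  have "Liminf (at_right 0) (\<lambda>t. local_energy M \<theta> p t u) = 0"
    using assms by (intro lim_imp_Liminf local_energy_tendsto_0) auto
  then have "(\<integral>\<^sup>+x. ennreal (\<bar>u x - mean_value M u\<bar> powr p) \<partial>M) = 0"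
    using sob u by (fastforce simp: sobolev_type_inequality_def)
  then have "AE x in M. ennreal (\<bar>u x - mean_value M u\<bar> powr p) = 0"
    by (subst (asm) nn_integral_0_iff_AE) auto
  then show ?thesis
    by eventually_elim simp
qed

theorem theorem1p6:
  fixes M :: "'a :: {metric_space, second_countable_topology} measure"
    and p \<theta> C :: real
  assumes "1 < p"
    and "doubling_metric_measure_space M"
    and "\<theta> > 0" and "C > 0"
    and "sobolev_type_inequality M \<theta> p C"
  shows "vectorspace.fin_dim class_ring (besov_space M \<theta> p) \<and>
         vectorspace.dim class_ring (besov_space M \<theta> p) \<le> 1"
proof -
  have M: "metric_measure_space M"
    using assms(2) by (simp add: doubling_metric_measure_space_def)
  let ?V = "besov_space M \<theta> p"
  interpret vectorspace class_ring ?V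
    using M assms(1) by (intro besov_space_vectorspace) auto
  have const: "\<exists>c. w = ae_class M (\<lambda>_. c)" if w: "w \<in> carrier ?V" for w
  proof -
    obtain u where "u \<in> besov_fun M \<theta> p" "w = ae_class M u"
      using w by (auto simp: besov_space_def)
    then show ?thesis
      using sobolev_type_inequality_AE_const[OF M _ assms(5)] assms(1,3)
      by (intro exI[of _ "mean_value M u"]) (simp add: ae_class_eqI)
  qed
  have smult: "a \<odot>\<^bsub>?V\<^esub> ae_class M (\<lambda>_. c) = ae_class M (\<lambda>_. a * c)" for a c
    by (simp add: besov_space_smult_class)
  obtain v where v: "v \<in> carrier ?V" "\<And>w. w \<in> carrier ?V \<Longrightarrow> \<exists>a. w = a \<odot>\<^bsub>?V\<^esub> v"
  \<comment> \<open>Constants have zero Besov energy, so a nonzero one belongs to the space exactly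
    when the total measure is finite. In that case it spans the space; otherwise only the zero class
    is left.\<close>
  proof (cases "\<exists>c. c \<noteq> 0 \<and> ae_class M (\<lambda>_. c) \<in> carrier ?V")
    case True
    then obtain c where c: "c \<noteq> 0" "ae_class M (\<lambda>_. c) \<in> carrier ?V" by blast
    have "\<exists>a. w = a \<odot>\<^bsub>?V\<^esub> ae_class M (\<lambda>_. c)" if w: "w \<in> carrier ?V" for w
    proof -
      obtain b where "w = ae_class M (\<lambda>_. b)" using const[OF w] by blast
      then have "w = (b / c) \<odot>\<^bsub>?V\<^esub> ae_class M (\<lambda>_. c)" using c(1) by (simp add: smult)
      then show ?thesis ..
    qed
    with c(2) that show ?thesis by blast
  next
    case False
    have "ae_class M (\<lambda>_. 0) \<in> carrier ?V"
      by (auto simp: besov_space_def besov_fun_zero)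
    moreover have "\<exists>a. w = a \<odot>\<^bsub>?V\<^esub> ae_class M (\<lambda>_. 0)" if w: "w \<in> carrier ?V" for w
      proof -
      obtain b where b: "w = ae_class M (\<lambda>_. b)" using const[OF w] by blast
      \<comment> \<open>The class of the constant \<open>b\<close> is \<open>w\<close> itself and
        hence lies in the space.\<close>
      with False w have "b = 0" by auto
      then have "w = 0 \<odot>\<^bsub>?V\<^esub> ae_class M (\<lambda>_. 0)" by (simp only: b smult mult_zero_left)
      then show ?thesis ..
    qed
    ultimately show ?thesis using that by blast
  qed
  then show ?thesis
    by (intro fin_dim_dim_le_1I) (auto simp: class_ring_simps)
qed

end
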